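(* Let $\Lambda$ be an Artinian algebra and let $M$ be a finitely generated left $\Lambda$-module which is faithful and indecomposable. If $M$ is torsionless, then $M$ is projective.
   Context: An Artinian algebra (Artin algebra) is a ring $\Lambda$ whose center $R$ is a commutative Artinian ring and which is finitely generated as an $R$-module. A module $M$ is faithful if its annihilator in $\Lambda$ is zero. Write $(-)^*=\operatorname{Hom}(-,\Lambda)$. A module $M$ is torsionless if the canonical evaluation homomorphism $\sigma_M:M\to M^{**}$, $\sigma_M(x)(f)=f(x)$ for $x\in M$, $f\in M^*$, is a monomorphism. *)

theory Defs
  imports "HOL-Algebra.Module" "HOL-Algebra.Ideal"
begin

section \<open>Left modules over a not necessarily commutative ring\<close>

text \<open>The locale \<open>module\<close> of HOL-Algebra requires a commutative ring of scalars.  The axioms are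
  the same here, over an arbitrary unital ring; the \<open>mult\<close> and \<open>one\<close> fields of the module record
  are never used.\<close>

locale left_module = R?: ring R + M?: abelian_group M
  for R :: "('a, 'r) ring_scheme" (structure) and M :: "('a, 'm, 's) module_scheme" (structure) +
  assumes smult_closed [simp, intro]:
      "\<lbrakk>a \<in> carrier R; x \<in> carrier M\<rbrakk> \<Longrightarrow> a \<odot>\<^bsub>M\<^esub> x \<in> carrier M"
    and smult_l_distr:
      "\<lbrakk>a \<in> carrier R; b \<in> carrier R; x \<in> carrier M\<rbrakk> \<Longrightarrow>
        (a \<oplus> b) \<odot>\<^bsub>M\<^esub> x = a \<odot>\<^bsub>M\<^esub> x \<oplus>\<^bsub>M\<^esub> b \<odot>\<^bsub>M\<^esub> x"
    and smult_r_distr: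
      "\<lbrakk>a \<in> carrier R; x \<in> carrier M; y \<in> carrier M\<rbrakk> \<Longrightarrow>
        a \<odot>\<^bsub>M\<^esub> (x \<oplus>\<^bsub>M\<^esub> y) = a \<odot>\<^bsub>M\<^esub> x \<oplus>\<^bsub>M\<^esub> a \<odot>\<^bsub>M\<^esub> y"
    and smult_assoc1:
      "\<lbrakk>a \<in> carrier R; b \<in> carrier R; x \<in> carrier M\<rbrakk> \<Longrightarrow>
        (a \<otimes> b) \<odot>\<^bsub>M\<^esub> x = a \<odot>\<^bsub>M\<^esub> (b \<odot>\<^bsub>M\<^esub> x)"
    and smult_one [simp]:
      "x \<in> carrier M \<Longrightarrow> \<one> \<odot>\<^bsub>M\<^esub> x = x"

definition module_hom ::
    "('a, 'r) ring_scheme \<Rightarrow> ('a, 'm, 's) module_scheme \<Rightarrow> ('a, 'n, 't) module_scheme \<Rightarrow> ('m \<Rightarrow> 'n) set"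
  where "module_hom R M N =
    {h \<in> carrier M \<rightarrow> carrier N.
      (\<forall>x \<in> carrier M. \<forall>y \<in> carrier M. h (x \<oplus>\<^bsub>M\<^esub> y) = h x \<oplus>\<^bsub>N\<^esub> h y) \<and>
      (\<forall>a \<in> carrier R. \<forall>x \<in> carrier M. h (a \<odot>\<^bsub>M\<^esub> x) = a \<odot>\<^bsub>N\<^esub> h x)}"

definition regular_module :: "('a, 'r) ring_scheme \<Rightarrow> ('a, 'a) module"
  where "regular_module R =
    \<lparr>carrier = carrier R, mult = mult R, one = one R, zero = zero R, add = add R,
     smult = mult R\<rparr>"

definition finitely_generated_module ::
    "('a, 'r) ring_scheme \<Rightarrow> ('a, 'm, 's) module_scheme \<Rightarrow> bool"
  where "finitely_generated_module R M \<longleftrightarrow>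
    (\<exists>G. finite G \<and> G \<subseteq> carrier M \<and>
      (\<forall>x \<in> carrier M. \<exists>c \<in> G \<rightarrow> carrier R. x = (\<Oplus>\<^bsub>M\<^esub>g \<in> G. c g \<odot>\<^bsub>M\<^esub> g)))"

definition annihilator ::
    "('a, 'r) ring_scheme \<Rightarrow> ('a, 'm, 's) module_scheme \<Rightarrow> 'a set"
  where "annihilator R M = {a \<in> carrier R. \<forall>x \<in> carrier M. a \<odot>\<^bsub>M\<^esub> x = \<zero>\<^bsub>M\<^esub>}"

definition faithful_module ::
    "('a, 'r) ring_scheme \<Rightarrow> ('a, 'm, 's) module_scheme \<Rightarrow> bool"
  where "faithful_module R M \<longleftrightarrow> annihilator R M = {\<zero>\<^bsub>R\<^esub>}"

text \<open>Indecomposable modules are nonzero by convention.\<close>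

definition indecomposable_module ::
    "('a, 'r) ring_scheme \<Rightarrow> ('a, 'm, 's) module_scheme \<Rightarrow> bool"
  where "indecomposable_module R M \<longleftrightarrow>
    carrier M \<noteq> {\<zero>\<^bsub>M\<^esub>} \<and>
    (\<forall>A B. submodule A R M \<and> submodule B R M \<and>
        A <+>\<^bsub>M\<^esub> B = carrier M \<and> A \<inter> B = {\<zero>\<^bsub>M\<^esub>} \<longrightarrow>
      A = {\<zero>\<^bsub>M\<^esub>} \<or> B = {\<zero>\<^bsub>M\<^esub>})"

text \<open>The lifting property along all epimorphisms \<open>p\<close> from \<open>N\<close> to \<open>P\<close>.  HOL cannot quantify
  over types inside a formula, so the element types of \<open>N\<close> and \<open>P\<close> are parameters.  A module is
  projective if this holds for all choices of them; in the conclusion of a theorem, leaving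
  \<open>'n\<close> and \<open>'p\<close> as free type variables expresses exactly that.\<close>

definition projective_module ::
    "'n itself \<Rightarrow> 'p itself \<Rightarrow> ('a, 'r) ring_scheme \<Rightarrow> ('a, 'm, 's) module_scheme \<Rightarrow> bool"
  where "projective_module _ _ R M \<longleftrightarrow>
    (\<forall>(N :: ('a, 'n) module) (P :: ('a, 'p) module) p f.
      left_module R N \<and> left_module R P \<and>
      p \<in> module_hom R N P \<and> p ` carrier N = carrier P \<and> f \<in> module_hom R M P \<longrightarrow>
      (\<exists>g \<in> module_hom R M N. \<forall>x \<in> carrier M. p (g x) = f x))"


section \<open>Duals and torsionless modules\<close>

text \<open>Right \<open>R\<close>-modules are represented as left modules over the opposite ring.\<close>

definition opposite_ring :: "('a, 'r) ring_scheme \<Rightarrow> ('a, 'r) ring_scheme"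
  where "opposite_ring R = R\<lparr>mult := (\<lambda>a b. b \<otimes>\<^bsub>R\<^esub> a)\<rparr>"

text \<open>For a left \<open>R\<close>-module \<open>M\<close>, the dual \<open>M\<^sup>*\<close> of homomorphisms from \<open>M\<close> to \<open>R\<close> is the right
  \<open>R\<close>-module with \<open>(f a)(x) = f(x) a\<close>, hence a left module over the opposite ring.
  Its elements are made extensional, so that homomorphisms equal on \<open>carrier M\<close> are identified.\<close>

definition dual_module ::
    "('a, 'r) ring_scheme \<Rightarrow> ('a, 'm, 's) module_scheme \<Rightarrow> ('a, 'm \<Rightarrow> 'a) module"
  where "dual_module R M =
    \<lparr>carrier = module_hom R M (regular_module R) \<inter> extensional (carrier M),
     mult = undefined, one = undefined,
     zero = (\<lambda>x \<in> carrier M. \<zero>\<^bsub>R\<^esub>),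
     add = (\<lambda>f g. \<lambda>x \<in> carrier M. f x \<oplus>\<^bsub>R\<^esub> g x),
     smult = (\<lambda>a f. \<lambda>x \<in> carrier M. f x \<otimes>\<^bsub>R\<^esub> a)\<rparr>"

definition bidual_module ::
    "('a, 'r) ring_scheme \<Rightarrow> ('a, 'm, 's) module_scheme \<Rightarrow> ('a, ('m \<Rightarrow> 'a) \<Rightarrow> 'a) module"
  where "bidual_module R M = dual_module (opposite_ring R) (dual_module R M)"

definition evaluation ::
    "('a, 'r) ring_scheme \<Rightarrow> ('a, 'm, 's) module_scheme \<Rightarrow> 'm \<Rightarrow> ('m \<Rightarrow> 'a) \<Rightarrow> 'a"
  where "evaluation R M x = (\<lambda>f \<in> carrier (dual_module R M). f x)"

definition torsionless_module ::
    "('a, 'r) ring_scheme \<Rightarrow> ('a, 'm, 's) module_scheme \<Rightarrow> bool"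
  where "torsionless_module R M \<longleftrightarrow>
    evaluation R M \<in> module_hom R M (bidual_module R M) \<and>
    inj_on (evaluation R M) (carrier M)"


section \<open>Artin algebras\<close>

locale commutative_artinian_ring = cring R for R (structure) +
  assumes descending_chain_condition:
    "\<lbrakk>\<And>n::nat. ideal (I n) R; \<And>n. I (Suc n) \<subseteq> I n\<rbrakk> \<Longrightarrow> \<exists>N. \<forall>n\<ge>N. I n = I N"

definition ring_center :: "('a, 'r) ring_scheme \<Rightarrow> 'a set"
  where "ring_center R = {z \<in> carrier R. \<forall>a \<in> carrier R. z \<otimes>\<^bsub>R\<^esub> a = a \<otimes>\<^bsub>R\<^esub> z}"

locale artin_algebra = ring R for R (structure) +
  assumes center_artinian: "commutative_artinian_ring (R\<lparr>carrier := ring_center R\<rparr>)"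
    and finitely_generated_over_center:
      "finitely_generated_module (R\<lparr>carrier := ring_center R\<rparr>) (regular_module R)"


section \<open>Consistency of the dual construction\<close>

lemma opposite_opposite_ring [simp]: "opposite_ring (opposite_ring R) = R"
  by (simp add: opposite_ring_def)

lemma opposite_ring_simps [simp]:
  "carrier (opposite_ring R) = carrier R"
  "zero (opposite_ring R) = zero R"
  "one (opposite_ring R) = one R"
  "add (opposite_ring R) = add R"
  "a \<otimes>\<^bsub>opposite_ring R\<^esub> b = b \<otimes>\<^bsub>R\<^esub> a"
  by (simp_all add: opposite_ring_def)

lemma (in ring) ring_opposite_ring: "ring (opposite_ring R)"
proof (rule ringI)
  show "abelian_group (opposite_ring R)"
  proof (rule abelian_groupI)
    show "\<exists>y\<in>carrier (opposite_ring R).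
        y \<oplus>\<^bsub>opposite_ring R\<^esub> x = \<zero>\<^bsub>opposite_ring R\<^esub>"
      if "x \<in> carrier (opposite_ring R)" for x
      using that by (auto intro: bexI[of _ "\<ominus> x"] simp: l_neg)
  qed (auto simp: a_ac)
  show "Group.monoid (opposite_ring R)"
    by (rule monoidI) (auto simp: m_assoc)
qed (auto simp: l_distr r_distr)

lemma (in left_module) left_module_dual:
  "left_module (opposite_ring R) (dual_module R M)"
proof -
  have ag: "abelian_group (dual_module R M)"
  proof (rule abelian_groupI)
    fix f assume f: "f \<in> carrier (dual_module R M)"
    define g where "g = (\<lambda>x\<in>carrier M. \<ominus> f x)"
    have "g \<in> carrier (dual_module R M)"
      using f by (auto simp: g_def dual_module_def module_hom_def regular_module_def Pi_iff
          R.minus_add r_minus)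
    moreover have "g \<oplus>\<^bsub>dual_module R M\<^esub> f = \<zero>\<^bsub>dual_module R M\<^esub>"
      using f by (auto simp: g_def dual_module_def module_hom_def regular_module_def Pi_iff
          R.l_neg intro!: restrict_ext)
    ultimately show "\<exists>g\<in>carrier (dual_module R M). g \<oplus>\<^bsub>dual_module R M\<^esub> f = \<zero>\<^bsub>dual_module R M\<^esub>"
      by blast
  next
    fix f assume f: "f \<in> carrier (dual_module R M)"
    show "\<zero>\<^bsub>dual_module R M\<^esub> \<oplus>\<^bsub>dual_module R M\<^esub> f = f"
      using f by (intro extensionalityI[where A = "carrier M"])
        (auto simp: dual_module_def module_hom_def regular_module_def Pi_iff)
  qed (auto simp: dual_module_def module_hom_def regular_module_def Pi_iff R.a_ac R.r_distr
      intro!: restrict_ext)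
  show ?thesis
  proof (intro left_module.intro left_module_axioms.intro ag ring_opposite_ring)
    fix f assume f: "f \<in> carrier (dual_module R M)"
    show "\<one>\<^bsub>opposite_ring R\<^esub> \<odot>\<^bsub>dual_module R M\<^esub> f = f"
      using f by (intro extensionalityI[where A = "carrier M"])
        (auto simp: dual_module_def module_hom_def regular_module_def Pi_iff)
  qed (auto simp: dual_module_def module_hom_def regular_module_def Pi_iff R.m_assoc
      R.l_distr R.r_distr intro!: restrict_ext)
qed

lemma (in left_module) left_module_bidual: "left_module R (bidual_module R M)"
  using left_module.left_module_dual[OF left_module_dual] by (simp add: bidual_module_def)

lemma (in left_module) evaluation_hom:
  "evaluation R M \<in> module_hom R M (bidual_module R M)"
proof -
  interpret D: left_module "opposite_ring R" "dual_module R M" by (rule left_module_dual)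
  have val: "f x \<in> carrier R" if "f \<in> carrier (dual_module R M)" "x \<in> carrier M" for f x
    using that by (auto simp: dual_module_def module_hom_def regular_module_def)
  have add: "(f \<oplus>\<^bsub>dual_module R M\<^esub> g) x = f x \<oplus> g x" if "x \<in> carrier M" for f g x
    using that by (simp add: dual_module_def)
  have smult: "(a \<odot>\<^bsub>dual_module R M\<^esub> f) x = f x \<otimes> a" if "x \<in> carrier M" for a f x
    using that by (simp add: dual_module_def)
  have hom_add: "f (x \<oplus>\<^bsub>M\<^esub> y) = f x \<oplus> f y"
    if "f \<in> carrier (dual_module R M)" "x \<in> carrier M" "y \<in> carrier M" for f x y
    using that by (auto simp: dual_module_def module_hom_def regular_module_def)
  have hom_smult: "f (a \<odot>\<^bsub>M\<^esub> x) = a \<otimes> f x"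
    if "f \<in> carrier (dual_module R M)" "x \<in> carrier M" "a \<in> carrier R" for f x a
    using that by (auto simp: dual_module_def module_hom_def regular_module_def)
  have carr: "evaluation R M x \<in> carrier (bidual_module R M)" if x: "x \<in> carrier M" for x
  proof -
    have "evaluation R M x \<in> module_hom (opposite_ring R) (dual_module R M)
        (regular_module (opposite_ring R))"
      using x D.smult_closed unfolding module_hom_def
      by (auto simp: evaluation_def regular_module_def val add smult)
    then show ?thesis
      unfolding bidual_module_def by (subst dual_module_def) (simp add: evaluation_def)
  qed
  have badd: "\<phi> \<oplus>\<^bsub>bidual_module R M\<^esub> \<psi> = (\<lambda>f\<in>carrier (dual_module R M). \<phi> f \<oplus> \<psi> f)"
    and bsm: "a \<odot>\<^bsub>bidual_module R M\<^esub> \<phi> = (\<lambda>f\<in>carrier (dual_module R M). a \<otimes> \<phi> f)"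
    for \<phi> \<psi> a
    unfolding bidual_module_def by (subst dual_module_def, simp)+
  show ?thesis
    unfolding module_hom_def
    by (auto simp: carr badd bsm, auto simp: evaluation_def hom_add hom_smult intro!: restrict_ext)
qed

lemma (in left_module) torsionless_module_iff:
  "torsionless_module R M \<longleftrightarrow> inj_on (evaluation R M) (carrier M)"
  by (simp add: torsionless_module_def evaluation_hom)

end

theory Submission
  imports Defs
begin

text \<open>Since \<open>\<Lambda>\<close> is finitely generated over its Artinian center, it satisfies the descending chain
  condition on submodules over the center, in particular on left and on right ideals.  Suppose first
  that some \<open>f \<in> M\<^sup>*\<close> has a value \<open>a = f(x)\<close> that is not nilpotent.  The left ideal \<open>\<Lambda>a\<close> then contains
  a nonzero idempotent \<open>e = f(y)\<close>; the map \<open>m \<mapsto> f(m)e\<close> splits off a direct summand \<open>\<Lambda>e\<close> of \<open>M\<close>, so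
  that \<open>M \<cong> \<Lambda>e\<close> is projective.  Otherwise all values of elements of \<open>M\<^sup>*\<close> are nilpotent.  Let \<open>s\<Lambda>\<close>
  be a minimal right ideal.  If \<open>s f(x) \<noteq> 0\<close>, then \<open>s = s f(x) b\<close> for some \<open>b\<close>, which is impossible
  because \<open>f(x) b = (f b)(x)\<close> is nilpotent.  Thus \<open>f(s x) = 0\<close> for all \<open>f\<close> and \<open>x\<close>, so \<open>s M = 0\<close>
  because \<open>M\<close> is torsionless, and \<open>M\<close> is not faithful.\<close>

section \<open>Chain conditions in Artin algebras\<close>

text \<open>Closure under negation is not demanded: minus one is central, so it follows from the
  last clause. Left ideals and right ideals are both instances, so that a single chain condition
  serves both sides.\<close>

definition center_submodule :: "('a, 'r) ring_scheme \<Rightarrow> 'a set \<Rightarrow> bool"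
  where "center_submodule R U \<longleftrightarrow>
    U \<subseteq> carrier R \<and> \<zero>\<^bsub>R\<^esub> \<in> U \<and> (\<forall>x \<in> U. \<forall>y \<in> U. x \<oplus>\<^bsub>R\<^esub> y \<in> U) \<and>
    (\<forall>z \<in> ring_center R. \<forall>x \<in> U. z \<otimes>\<^bsub>R\<^esub> x \<in> U)"

lemma ring_center_closed: "z \<in> ring_center R \<Longrightarrow> z \<in> carrier R"
  by (simp add: ring_center_def)

lemma ring_center_commute:
  "\<lbrakk>z \<in> ring_center R; a \<in> carrier R\<rbrakk> \<Longrightarrow> z \<otimes>\<^bsub>R\<^esub> a = a \<otimes>\<^bsub>R\<^esub> z"
  by (simp add: ring_center_def)

lemma ring_centerI:
  "\<lbrakk>z \<in> carrier R; \<And>a. a \<in> carrier R \<Longrightarrow> z \<otimes>\<^bsub>R\<^esub> a = a \<otimes>\<^bsub>R\<^esub> z\<rbrakk> \<Longrightarrow> z \<in> ring_center R"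
  by (simp add: ring_center_def)

section \<open>Closure properties of the center and of submodules over it\<close>

context ring
begin

lemma ring_center_zero: "\<zero> \<in> ring_center R"
  by (rule ring_centerI) simp_all

lemma ring_center_one: "\<one> \<in> ring_center R"
  by (rule ring_centerI) simp_all

lemma ring_center_add:
  assumes "a \<in> ring_center R" "b \<in> ring_center R"
  shows "a \<oplus> b \<in> ring_center R"
proof (rule ring_centerI)
  fix x assume "x \<in> carrier R"
  with assms show "(a \<oplus> b) \<otimes> x = x \<otimes> (a \<oplus> b)"
    using ring_center_commute[OF assms(1), of x] ring_center_commute[OF assms(2), of x]
    by (simp add: ring_center_closed l_distr r_distr)
qed (use assms in \<open>simp add: ring_center_closed\<close>)

lemma ring_center_mult:
  assumes "a \<in> ring_center R" "b \<in> ring_center R"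
  shows "a \<otimes> b \<in> ring_center R"
proof (rule ring_centerI)
  fix x assume "x \<in> carrier R"
  with assms show "a \<otimes> b \<otimes> x = x \<otimes> (a \<otimes> b)"
    by (metis m_assoc ring_center_closed ring_center_commute)
qed (use assms in \<open>simp add: ring_center_closed\<close>)

lemma ring_center_minus_one: "\<ominus> \<one> \<in> ring_center R"
  by (rule ring_centerI) (simp_all add: l_minus r_minus)

lemma center_submodule_diff:
  assumes "center_submodule R U" "x \<in> U" "y \<in> U"
  shows "x \<ominus> y \<in> U"
proof -
  have "x \<ominus> y = x \<oplus> \<ominus> \<one> \<otimes> y"
    using assms by (auto simp: center_submodule_def l_minus minus_eq)
  then show ?thesis
    using assms ring_center_minus_one by (simp add: center_submodule_def)
qed

lemma center_submodule_principal_left: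
  assumes b: "b \<in> carrier R"
  shows "center_submodule R ((\<lambda>r. r \<otimes> b) ` carrier R)"
proof -
  have "\<zero> \<in> (\<lambda>r. r \<otimes> b) ` carrier R"
    using b by (intro image_eqI[of _ _ \<zero>]) auto
  moreover have "r \<otimes> b \<oplus> r' \<otimes> b \<in> (\<lambda>r. r \<otimes> b) ` carrier R"
    if "r \<in> carrier R" "r' \<in> carrier R" for r r'
    using b that by (intro image_eqI[of _ _ "r \<oplus> r'"]) (auto simp: l_distr)
  moreover have "z \<otimes> (r \<otimes> b) \<in> (\<lambda>r. r \<otimes> b) ` carrier R"
    if "r \<in> carrier R" "z \<in> ring_center R" for r z
    using b that by (intro image_eqI[of _ _ "z \<otimes> r"]) (auto simp: m_assoc ring_center_closed)
  ultimately show ?thesis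
    using b unfolding center_submodule_def by blast
qed

lemma center_submodule_principal_right:
  assumes b: "b \<in> carrier R"
  shows "center_submodule R ((\<lambda>r. b \<otimes> r) ` carrier R)"
proof -
  have "\<zero> \<in> (\<lambda>r. b \<otimes> r) ` carrier R"
    using b by (intro image_eqI[of _ _ \<zero>]) auto
  moreover have "b \<otimes> r \<oplus> b \<otimes> r' \<in> (\<lambda>r. b \<otimes> r) ` carrier R"
    if "r \<in> carrier R" "r' \<in> carrier R" for r r'
    using b that by (intro image_eqI[of _ _ "r \<oplus> r'"]) (auto simp: r_distr)
  moreover have "z \<otimes> (b \<otimes> r) \<in> (\<lambda>r. b \<otimes> r) ` carrier R"
    if "r \<in> carrier R" "z \<in> ring_center R" for r z
  \<comment> \<open>A central \<open>z\<close> can be moved past \<open>b \<otimes> r\<close> to the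
    right end, where it is absorbed into the right factor.\<close>
  proof (intro image_eqI[of _ _ "r \<otimes> z"])
    have "z \<otimes> (b \<otimes> r) = b \<otimes> r \<otimes> z"
      using b that by (intro ring_center_commute) simp_all
    then show "z \<otimes> (b \<otimes> r) = b \<otimes> (r \<otimes> z)"
      using b that by (simp add: m_assoc ring_center_closed)
  qed (use that in \<open>simp add: ring_center_closed\<close>)
  ultimately show ?thesis
    using b unfolding center_submodule_def by blast
qed

text \<open>With Z for the center, this set is the sum Z g + W. It serves to build up the whole ring
  one generator at a time.\<close>

lemma center_submodule_add_multiples:
  assumes W: "center_submodule R W" and g: "g \<in> carrier R"
  shows "center_submodule R {r \<otimes> g \<oplus> w |r w. r \<in> ring_center R \<and> w \<in> W}" (is "center_submodule R ?V")
proof -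
  have Wc: "w \<in> carrier R" if "w \<in> W" for w
    using W that by (auto simp: center_submodule_def)
  have "\<zero> = \<zero> \<otimes> g \<oplus> \<zero>"
    using g by simp
  then have zero: "\<zero> \<in> ?V"
    using W ring_center_zero unfolding center_submodule_def by blast
  have add: "(r \<otimes> g \<oplus> w) \<oplus> (r' \<otimes> g \<oplus> w') \<in> ?V"
    if "r \<in> ring_center R" "w \<in> W" "r' \<in> ring_center R" "w' \<in> W" for r w r' w'
  proof -
    have "(r \<otimes> g \<oplus> w) \<oplus> (r' \<otimes> g \<oplus> w') = (r \<oplus> r') \<otimes> g \<oplus> (w \<oplus> w')"
      using that g by (simp add: Wc ring_center_closed l_distr a_ac)
    moreover have "r \<oplus> r' \<in> ring_center R" "w \<oplus> w' \<in> W"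
      using that W by (auto simp: ring_center_add center_submodule_def)
    ultimately show ?thesis
      by blast
  qed
  have mult: "z \<otimes> (r \<otimes> g \<oplus> w) \<in> ?V"
    if "z \<in> ring_center R" "r \<in> ring_center R" "w \<in> W" for z r w
  proof -
    have "z \<otimes> (r \<otimes> g \<oplus> w) = z \<otimes> r \<otimes> g \<oplus> z \<otimes> w"
      using that g by (simp add: Wc ring_center_closed r_distr m_assoc)
    moreover have "z \<otimes> r \<in> ring_center R" "z \<otimes> w \<in> W"
      using that W by (auto simp: ring_center_mult center_submodule_def)
    ultimately show ?thesis
      by blast
  qed
  have "?V \<subseteq> carrier R"
    using g Wc by (auto simp: ring_center_closed)
  then show ?thesis
    using zero add mult unfolding center_submodule_def by blast
qed

lemma center_submodule_finsum:
  assumes "center_submodule R W" "finite G" "\<And>g. g \<in> G \<Longrightarrow> h g \<in> W"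
  shows "finsum R h G \<in> W"
  using assms(2,3)
proof (induction G)
  case empty
  then show ?case
    using assms(1) by (simp add: center_submodule_def)
next
  case (insert g G)
  have "h \<in> insert g G \<rightarrow> carrier R"
    using assms(1) insert.prems by (auto simp: center_submodule_def)
  then have "finsum R h (insert g G) = h g \<oplus> finsum R h G"
    using insert.hyps by (subst finsum_insert) auto
  then show ?case
    using assms(1) insert by (auto simp: center_submodule_def)
qed

end

section \<open>The chain condition on submodules over the center, and the idempotents and minimal
  right ideals that it yields\<close>

context artin_algebra
begin

text \<open>For a center-submodule \<open>U\<close>, the set of leading coefficients \<open>r\<close> is an ideal of the center; it
  controls the growth of \<open>U\<close> when a generator \<open>g\<close> is added to \<open>W\<close>.\<close>

lemma ideal_leading_coefficients:
  assumes U: "center_submodule R U" and W: "center_submodule R W" and g: "g \<in> carrier R"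
  shows "ideal {r \<in> ring_center R. \<exists>w \<in> W. r \<otimes> g \<oplus> w \<in> U} (R\<lparr>carrier := ring_center R\<rparr>)"
    (is "ideal ?I ?Z")
proof -
  interpret Z: commutative_artinian_ring ?Z
    by (rule center_artinian)
  have Wc: "w \<in> carrier R" if "w \<in> W" for w
    using W that by (auto simp: center_submodule_def)
  have zero: "\<zero> \<in> ?I"
    using U W g ring_center_zero by (auto simp: center_submodule_def intro!: bexI[of _ \<zero>])
  have add: "a \<oplus> b \<in> ?I" if a: "a \<in> ?I" and b: "b \<in> ?I" for a b
  proof -
    obtain v w where "v \<in> W" "w \<in> W" "a \<otimes> g \<oplus> v \<in> U" "b \<otimes> g \<oplus> w \<in> U"
      using a b by blast
    moreover from this have "(a \<oplus> b) \<otimes> g \<oplus> (v \<oplus> w) = (a \<otimes> g \<oplus> v) \<oplus> (b \<otimes> g \<oplus> w)"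
      using a b g by (simp add: Wc ring_center_closed l_distr a_ac)
    ultimately show ?thesis
      using a b U W by (auto simp: center_submodule_def ring_center_add intro!: bexI[of _ "v \<oplus> w"])
  qed
  have mult: "z \<otimes> a \<in> ?I" if z: "z \<in> ring_center R" and a: "a \<in> ?I" for z a
  proof -
    obtain v where "v \<in> W" "a \<otimes> g \<oplus> v \<in> U"
      using a by blast
    moreover from this have "z \<otimes> a \<otimes> g \<oplus> z \<otimes> v = z \<otimes> (a \<otimes> g \<oplus> v)"
      using a z g by (simp add: Wc ring_center_closed r_distr m_assoc)
    ultimately show ?thesis
      using a z U W by (auto simp: center_submodule_def ring_center_mult intro!: bexI[of _ "z \<otimes> v"])
  qed
  \<comment> \<open>This negative is formed in the center as a ring of its own. As a product with
    the minus one of that ring it is covered by \<open>mult\<close>.\<close>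
  have neg: "\<ominus>\<^bsub>?Z\<^esub> a \<in> ?I" if a: "a \<in> ?I" for a
  proof -
    have "\<ominus>\<^bsub>?Z\<^esub> a = \<ominus>\<^bsub>?Z\<^esub> \<one>\<^bsub>?Z\<^esub> \<otimes>\<^bsub>?Z\<^esub> a"
      using a Z.l_minus[of "\<one>\<^bsub>?Z\<^esub>" a] Z.one_closed Z.l_one[of a] by simp
    moreover have "\<ominus>\<^bsub>?Z\<^esub> \<one>\<^bsub>?Z\<^esub> \<in> ring_center R"
      using Z.a_inv_closed[OF Z.one_closed] by simp
    ultimately show ?thesis
      using mult[OF _ a] by simp
  qed
  have "a \<otimes> z \<in> ?I" if z: "z \<in> ring_center R" and a: "a \<in> ?I" for z a
    using mult[OF z a] ring_center_commute[OF z, of a] a by (simp add: ring_center_closed)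
  moreover have "subgroup ?I (add_monoid ?Z)"
    using zero add neg by (intro subgroup.intro) (auto simp: a_inv_def)
  ultimately show ?thesis
    using mult by (intro idealI Z.ring_axioms) auto
qed

text \<open>This is the argument that an extension of Artinian modules is Artinian, carried out for
  one chain. From some index on, the ideals of leading coefficients and the intersections with
  \<open>W\<close> are both constant. Given r g + w in \<open>U N\<close>, the first fact provides r
  g + w' in \<open>U n\<close> with the same r; the difference w - w' lies in
  \<open>U N \<inter> W\<close>, hence in \<open>U n\<close>, and adding it back gives r g + w in
  \<open>U n\<close>.\<close>

lemma chain_condition_add_generator:
  assumes g: "g \<in> carrier R" and W: "center_submodule R W"
    and U: "\<And>n. center_submodule R (U n)" and dec: "\<And>n. U (Suc n) \<subseteq> U n"
    and stable: "\<exists>N. \<forall>n\<ge>N. U n \<inter> W = U N \<inter> W"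
  shows "\<exists>N. \<forall>n\<ge>N. U n \<inter> {r \<otimes> g \<oplus> w |r w. r \<in> ring_center R \<and> w \<in> W} =
    U N \<inter> {r \<otimes> g \<oplus> w |r w. r \<in> ring_center R \<and> w \<in> W}"
proof -
  interpret Z: commutative_artinian_ring "R\<lparr>carrier := ring_center R\<rparr>"
    by (rule center_artinian)
  have Uc: "x \<in> carrier R" if "x \<in> U n" for x n
    using U that unfolding center_submodule_def by blast
  have Wc: "w \<in> carrier R" if "w \<in> W" for w
    using W that by (auto simp: center_submodule_def)
  have anti: "U n \<subseteq> U k" if "k \<le> n" for k n
    using dec that by (rule lift_Suc_antimono_le)
  define I where "I n = {r \<in> ring_center R. \<exists>w \<in> W. r \<otimes> g \<oplus> w \<in> U n}" for n
  have "\<exists>N. \<forall>n\<ge>N. I n = I N"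
  proof (rule Z.descending_chain_condition)
    show "ideal (I n) (R\<lparr>carrier := ring_center R\<rparr>)" for n
      unfolding I_def by (rule ideal_leading_coefficients[OF U W g])
    show "I (Suc n) \<subseteq> I n" for n
      using dec unfolding I_def by blast
  qed
  then obtain N1 where N1: "\<And>n. n \<ge> N1 \<Longrightarrow> I n = I N1"
    by blast
  obtain N2 where N2: "\<And>n. n \<ge> N2 \<Longrightarrow> U n \<inter> W = U N2 \<inter> W"
    using stable by blast
  define N where "N = max N1 N2"
  have "r \<otimes> g \<oplus> w \<in> U n"
    if n: "n \<ge> N" and r: "r \<in> ring_center R" and w: "w \<in> W" and x: "r \<otimes> g \<oplus> w \<in> U N" for n r w
  proof -
    have "r \<in> I N"
      using r w x by (auto simp: I_def)
    then have "r \<in> I n"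
      using N1[of n] N1[of N] n by (simp add: N_def)
    then obtain w' where w': "w' \<in> W" "r \<otimes> g \<oplus> w' \<in> U n"
      by (auto simp: I_def)
    have eq: "(r \<otimes> g \<oplus> w) \<ominus> (r \<otimes> g \<oplus> w') = w \<ominus> w'"
      using r w w' g by (simp add: ring_center_closed Wc minus_eq minus_add a_ac r_neg r_neg1 r_neg2)
    have "r \<otimes> g \<oplus> w' \<in> U N"
      using w' anti[OF n] by blast
    then have "w \<ominus> w' \<in> U N"
      using center_submodule_diff[OF U x] eq by fastforce
    moreover have "w \<ominus> w' \<in> W"
      using center_submodule_diff[OF W] w w' by blast
    moreover have "U n \<inter> W = U N \<inter> W"
      using N2[of n] N2[of N] n by (simp add: N_def)
    ultimately have "w \<ominus> w' \<in> U n"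
      by blast
    then have "(r \<otimes> g \<oplus> w') \<oplus> (w \<ominus> w') \<in> U n"
      using w' U unfolding center_submodule_def by blast
    moreover have "(r \<otimes> g \<oplus> w') \<oplus> (w \<ominus> w') = (r \<otimes> g \<oplus> w) \<oplus> (w' \<ominus> w')"
      using r w w' g by (simp add: ring_center_closed Wc minus_eq a_ac)
    moreover have "\<dots> = r \<otimes> g \<oplus> w"
      using r w w' g by (simp add: ring_center_closed Wc minus_eq r_neg)
    ultimately show ?thesis
      by simp
  qed
  then show ?thesis
    using anti by (intro exI[of _ N]) blast
qed

text \<open>Induction over a finite generating set of the ring over its center: starting from zero,
  \<open>W\<close> grows by one generator at a time while the chain remains eventually constant on
  \<open>W\<close>. A \<open>W\<close> that contains all generators is the whole ring.\<close>

lemma descending_center_submodules: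
  assumes U: "\<And>n. center_submodule R (U n)" and dec: "\<And>n. U (Suc n) \<subseteq> U n"
  shows "\<exists>N. \<forall>n\<ge>N. U n = U N"
proof -
  obtain G where G: "finite G" "G \<subseteq> carrier R"
    and gen: "\<And>x. x \<in> carrier R \<Longrightarrow>
      \<exists>c \<in> G \<rightarrow> ring_center R. x = finsum (regular_module R) (\<lambda>g. c g \<otimes> g) G"
    using finitely_generated_over_center
    by (auto simp: finitely_generated_module_def regular_module_def)
  have "\<exists>W. center_submodule R W \<and> G \<subseteq> W \<and> (\<exists>N. \<forall>n\<ge>N. U n \<inter> W = U N \<inter> W)"
    using G
  proof (induction G)
    case empty
    have "center_submodule R {\<zero>}"
      by (auto simp: center_submodule_def ring_center_closed)
    moreover have "U n \<inter> {\<zero>} = {\<zero>}" for n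
      using U[of n] by (auto simp: center_submodule_def)
    ultimately show ?case
      by blast
  next
    case (insert g G)
    then obtain W where W: "center_submodule R W" "G \<subseteq> W" "\<exists>N. \<forall>n\<ge>N. U n \<inter> W = U N \<inter> W"
      by blast
    define V where "V = {r \<otimes> g \<oplus> w |r w. r \<in> ring_center R \<and> w \<in> W}"
    have Wc: "W \<subseteq> carrier R" "\<zero> \<in> W"
      using W by (auto simp: center_submodule_def)
    have g: "g \<in> carrier R"
      using insert by simp
    have "center_submodule R V"
      unfolding V_def by (rule center_submodule_add_multiples[OF W(1) g])
    moreover have "\<exists>N. \<forall>n\<ge>N. U n \<inter> V = U N \<inter> V"
      unfolding V_def by (rule chain_condition_add_generator[OF g W(1) U dec W(3)])
    moreover have "g \<in> V"
      using Wc g ring_center_one unfolding V_def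
      by (intro CollectI exI[of _ \<one>] exI[of _ \<zero>]) auto
    moreover have "w \<in> V" if "w \<in> W" for w
      using Wc g that ring_center_zero unfolding V_def
      by (intro CollectI exI[of _ \<zero>] exI[of _ w]) auto
    ultimately show ?case
      using W(2) by (intro exI[of _ V]) auto
  qed
  then obtain W N where W: "center_submodule R W" "G \<subseteq> W" and N: "\<forall>n\<ge>N. U n \<inter> W = U N \<inter> W"
    by blast
  have "x \<in> W" if "x \<in> carrier R" for x
  proof -
    obtain c where c: "c \<in> G \<rightarrow> ring_center R" "x = finsum (regular_module R) (\<lambda>g. c g \<otimes> g) G"
      using gen[OF \<open>x \<in> carrier R\<close>] by blast
    \<comment> \<open>The sum was formed in \<open>regular_module R\<close>; unfolded, it depends
      only on the carrier, the addition and the zero, which are those of \<open>R\<close>.\<close>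
    have "x = finsum R (\<lambda>g. c g \<otimes> g) G"
      by (simp add: c(2) finsum_def finprod_def regular_module_def)
    also have "\<dots> \<in> W"
    proof (rule center_submodule_finsum[OF W(1) G(1)])
      fix g assume "g \<in> G"
      then show "c g \<otimes> g \<in> W"
        using W c(1) unfolding center_submodule_def by (blast dest: funcset_mem)
    qed
    finally show ?thesis .
  qed
  then have "U n \<inter> W = U n" for n
    using U[of n] by (auto simp: center_submodule_def)
  then show ?thesis
    using N by auto
qed

text \<open>The chains of left ideals R a^n and of right ideals a^n R become stationary. Beyond that
  point the exponents k and 2k give the same ideals, so a^k is a left and a right multiple of a^k
  a^k. The exponent is written \<open>Suc n\<close> because it must be positive: the idempotent
  built from this power has to be a left multiple of \<open>a\<close>.\<close>

lemma strongly_pi_regular: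
  assumes a: "a \<in> carrier R"
  shows "\<exists>n c d. c \<in> carrier R \<and> d \<in> carrier R \<and>
    a [^] Suc n = c \<otimes> (a [^] Suc n \<otimes> a [^] Suc n) \<and>
    a [^] Suc n = a [^] Suc n \<otimes> a [^] Suc n \<otimes> d"
proof -
  define L where "L n = (\<lambda>r. r \<otimes> a [^] n) ` carrier R" for n :: nat
  define L' where "L' n = (\<lambda>r. a [^] n \<otimes> r) ` carrier R" for n :: nat
  have "L (Suc n) \<subseteq> L n" for n
  proof -
    have "r \<otimes> a [^] Suc n = r \<otimes> a \<otimes> a [^] n" if "r \<in> carrier R" for r
      using a that by (simp only: nat_pow_Suc2 m_assoc nat_pow_closed)
    then show ?thesis
      using a unfolding L_def by (auto simp del: nat_pow_Suc)
  qed
  moreover have "center_submodule R (L n)" for n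
    unfolding L_def using a by (intro center_submodule_principal_left) simp
  ultimately obtain N where N: "\<And>n. n \<ge> N \<Longrightarrow> L n = L N"
    using descending_center_submodules[of L] by blast
  have "L' (Suc n) \<subseteq> L' n" for n
    unfolding L'_def using a by (auto simp: m_assoc)
  moreover have "center_submodule R (L' n)" for n
    unfolding L'_def using a by (intro center_submodule_principal_right) simp
  ultimately obtain N' where N': "\<And>n. n \<ge> N' \<Longrightarrow> L' n = L' N'"
    using descending_center_submodules[of L'] by blast
  define n where "n = max N N'"
  have "L (Suc n) = L (Suc n + Suc n)" "L' (Suc n) = L' (Suc n + Suc n)"
    using N[of "Suc n"] N[of "Suc n + Suc n"] N'[of "Suc n"] N'[of "Suc n + Suc n"]
    by (simp_all add: n_def)
  moreover have "a [^] Suc n \<in> L (Suc n)"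
    unfolding L_def using a by (intro image_eqI[of _ _ \<one>]) auto
  moreover have "a [^] Suc n \<in> L' (Suc n)"
    unfolding L'_def using a by (intro image_eqI[of _ _ \<one>]) auto
  ultimately have "a [^] Suc n \<in> L (Suc n + Suc n)" "a [^] Suc n \<in> L' (Suc n + Suc n)"
    by simp_all
  moreover have "a [^] (Suc n + Suc n) = a [^] Suc n \<otimes> a [^] Suc n"
    using a by (simp only: nat_pow_mult)
  ultimately show ?thesis
    unfolding L_def L'_def by (auto simp del: nat_pow_Suc)
qed

text \<open>For the power b from pi-regularity, b = c b b = b b d gives c b = c b b d = b d. Hence
  (c b)(c b) = c b b d = c b, and c b is nonzero because (c b) b = b is.\<close>

lemma idempotent_multiple_of_nonnilpotent:
  assumes a: "a \<in> carrier R" and nonnil: "\<And>n::nat. a [^] n \<noteq> \<zero>"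
  obtains c where "c \<in> carrier R" "c \<otimes> a \<noteq> \<zero>" "(c \<otimes> a) \<otimes> (c \<otimes> a) = c \<otimes> a"
proof -
  obtain n c d where c: "c \<in> carrier R" and d: "d \<in> carrier R"
    and left: "a [^] Suc n = c \<otimes> (a [^] Suc n \<otimes> a [^] Suc n)"
    and right: "a [^] Suc n = a [^] Suc n \<otimes> a [^] Suc n \<otimes> d"
    using strongly_pi_regular[OF a] by blast
  define b where "b = a [^] Suc n"
  have b: "b \<in> carrier R" and cbb: "b = c \<otimes> (b \<otimes> b)" and bbd: "b = b \<otimes> b \<otimes> d"
    using a left right unfolding b_def by (simp_all del: nat_pow_Suc)
  have "c \<otimes> b = c \<otimes> (b \<otimes> b) \<otimes> d"
    using bbd b c d by (metis m_assoc m_closed)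
  then have cb: "c \<otimes> b = b \<otimes> d"
    using cbb by simp
  have "(c \<otimes> b) \<otimes> (c \<otimes> b) = (c \<otimes> b) \<otimes> (b \<otimes> d)"
    using cb by simp
  also have "\<dots> = c \<otimes> (b \<otimes> b) \<otimes> d"
    using b c d by (simp add: m_assoc)
  also have "\<dots> = c \<otimes> b"
    using cbb cb by simp
  finally have idem: "(c \<otimes> b) \<otimes> (c \<otimes> b) = c \<otimes> b" .
  have "b \<noteq> \<zero>"
    unfolding b_def by (rule nonnil)
  moreover have "b = (c \<otimes> b) \<otimes> b"
    using cbb b c by (simp add: m_assoc)
  ultimately have nz: "c \<otimes> b \<noteq> \<zero>"
    using b by auto
  \<comment> \<open>One factor \<open>a\<close> is split off on the right, so the coefficient to be
    returned is \<open>c \<otimes> a [^] n\<close> and not \<open>c\<close>.\<close>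
  have "c \<otimes> b = (c \<otimes> a [^] n) \<otimes> a"
    using a c by (simp add: b_def m_assoc)
  then show thesis
    using idem nz a c that[of "c \<otimes> a [^] n"] by simp
qed

text \<open>The last condition expresses minimality of s R through elements: every nonzero multiple
  s r generates s again. Without such an s, each nonzero x has a nonzero multiple x r whose right
  ideal misses x, and dependent choice produces a strictly descending chain of right ideals.\<close>

lemma minimal_right_ideal:
  assumes "\<one> \<noteq> \<zero>"
  obtains s where "s \<in> carrier R" "s \<noteq> \<zero>"
    "\<And>r. \<lbrakk>r \<in> carrier R; s \<otimes> r \<noteq> \<zero>\<rbrakk> \<Longrightarrow> \<exists>t \<in> carrier R. s = s \<otimes> r \<otimes> t"
proof (rule ccontr)
  note minimal = that
  assume no_minimal: "\<not> thesis"
  have step: "\<exists>y. (y \<in> carrier R \<and> y \<noteq> \<zero>) \<and>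
      (\<lambda>r. y \<otimes> r) ` carrier R \<subset> (\<lambda>r. x \<otimes> r) ` carrier R"
    if x: "x \<in> carrier R \<and> x \<noteq> \<zero>" for x
  proof -
    have "\<exists>r \<in> carrier R. x \<otimes> r \<noteq> \<zero> \<and> (\<forall>t \<in> carrier R. x \<noteq> x \<otimes> r \<otimes> t)"
    proof (rule ccontr)
      assume "\<not> ?thesis"
      then have alt: "x \<otimes> r = \<zero> \<or> (\<exists>t \<in> carrier R. x = x \<otimes> r \<otimes> t)" if "r \<in> carrier R" for r
        using that by simp
      have "\<exists>t \<in> carrier R. x = x \<otimes> r \<otimes> t" if "r \<in> carrier R" "x \<otimes> r \<noteq> \<zero>" for r
        using alt[OF that(1)] that(2) by (elim disjE) (rule notE)
      then have thesis
        using x by (intro minimal[of x]) simp_all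
      with no_minimal show False ..
    qed
    then obtain r where r: "r \<in> carrier R" "x \<otimes> r \<noteq> \<zero>"
      and ne: "\<And>t. t \<in> carrier R \<Longrightarrow> x \<noteq> x \<otimes> r \<otimes> t"
      by blast
    have "(\<lambda>t. x \<otimes> r \<otimes> t) ` carrier R \<subseteq> (\<lambda>r. x \<otimes> r) ` carrier R"
      using x r by (auto simp: m_assoc)
    moreover have "x \<in> (\<lambda>r. x \<otimes> r) ` carrier R"
      using x by (intro image_eqI[of _ _ \<one>]) auto
    moreover have "x \<notin> (\<lambda>t. x \<otimes> r \<otimes> t) ` carrier R"
      using ne by blast
    ultimately show ?thesis
      using x r by (intro exI[of _ "x \<otimes> r"]) auto
  qed
  have "\<exists>x. \<forall>n::nat. (x n \<in> carrier R \<and> x n \<noteq> \<zero>) \<and>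
      (\<lambda>r. x (Suc n) \<otimes> r) ` carrier R \<subset> (\<lambda>r. x n \<otimes> r) ` carrier R"
  proof (rule dependent_nat_choice)
    show "\<exists>x. x \<in> carrier R \<and> x \<noteq> \<zero>"
      using assms by blast
  qed (rule step)
  then obtain x where "\<forall>n::nat. (x n \<in> carrier R \<and> x n \<noteq> \<zero>) \<and>
      (\<lambda>r. x (Suc n) \<otimes> r) ` carrier R \<subset> (\<lambda>r. x n \<otimes> r) ` carrier R" ..
  then have x: "x n \<in> carrier R"
    and psubset: "(\<lambda>r. x (Suc n) \<otimes> r) ` carrier R \<subset> (\<lambda>r. x n \<otimes> r) ` carrier R" for n
    by simp_all
  have "\<exists>N. \<forall>n\<ge>N. (\<lambda>r. x n \<otimes> r) ` carrier R = (\<lambda>r. x N \<otimes> r) ` carrier R"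
    using x psubset_imp_subset[OF psubset]
    by (intro descending_center_submodules center_submodule_principal_right)
  then obtain N where N: "\<forall>n\<ge>N. (\<lambda>r. x n \<otimes> r) ` carrier R = (\<lambda>r. x N \<otimes> r) ` carrier R" ..
  show False
    using psubset[of N] N[rule_format, of "Suc N"] by simp
qed

end


section \<open>Splitting off a summand generated by an idempotent\<close>

lemma module_hom_closed: "\<lbrakk>f \<in> module_hom R M N; x \<in> carrier M\<rbrakk> \<Longrightarrow> f x \<in> carrier N"
  by (auto simp: module_hom_def)

lemma module_hom_add:
  "\<lbrakk>f \<in> module_hom R M N; x \<in> carrier M; y \<in> carrier M\<rbrakk> \<Longrightarrow> f (x \<oplus>\<^bsub>M\<^esub> y) = f x \<oplus>\<^bsub>N\<^esub> f y"
  by (simp add: module_hom_def)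

lemma module_hom_smult:
  "\<lbrakk>f \<in> module_hom R M N; a \<in> carrier R; x \<in> carrier M\<rbrakk> \<Longrightarrow> f (a \<odot>\<^bsub>M\<^esub> x) = a \<odot>\<^bsub>N\<^esub> f x"
  by (simp add: module_hom_def)

lemma regular_module_simps [simp]:
  "carrier (regular_module R) = carrier R"
  "zero (regular_module R) = zero R"
  "add (regular_module R) = add R"
  "smult (regular_module R) = mult R"
  by (simp_all add: regular_module_def)

context left_module
begin

lemma smult_l_null:
  assumes "x \<in> carrier M"
  shows "\<zero> \<odot>\<^bsub>M\<^esub> x = \<zero>\<^bsub>M\<^esub>"
proof -
  have "\<zero> \<odot>\<^bsub>M\<^esub> x \<oplus>\<^bsub>M\<^esub> \<zero> \<odot>\<^bsub>M\<^esub> x = \<zero> \<odot>\<^bsub>M\<^esub> x"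
    using assms smult_l_distr[of \<zero> \<zero> x] by simp
  then show ?thesis
    using assms by (metis M.add.l_cancel_one R.zero_closed smult_closed)
qed

lemma smult_minus_one:
  assumes "x \<in> carrier M"
  shows "(\<ominus> \<one>) \<odot>\<^bsub>M\<^esub> x = \<ominus>\<^bsub>M\<^esub> x"
proof (rule M.minus_equality[symmetric])
  show "(\<ominus> \<one>) \<odot>\<^bsub>M\<^esub> x \<oplus>\<^bsub>M\<^esub> x = \<zero>\<^bsub>M\<^esub>"
    using assms smult_l_distr[of "\<ominus> \<one>" \<one> x] by (simp add: R.l_neg smult_l_null)
qed (use assms in auto)

lemma submoduleI:
  assumes "A \<subseteq> carrier M" "\<zero>\<^bsub>M\<^esub> \<in> A" "\<And>x y. \<lbrakk>x \<in> A; y \<in> A\<rbrakk> \<Longrightarrow> x \<oplus>\<^bsub>M\<^esub> y \<in> A"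
    "\<And>a x. \<lbrakk>a \<in> carrier R; x \<in> A\<rbrakk> \<Longrightarrow> a \<odot>\<^bsub>M\<^esub> x \<in> A"
  shows "submodule A R M"
proof -
  have "\<ominus>\<^bsub>M\<^esub> x \<in> A" if "x \<in> A" for x
  proof -
    have "(\<ominus> \<one>) \<odot>\<^bsub>M\<^esub> x \<in> A"
      using that by (intro assms(4)) simp
    then show ?thesis
      using assms(1) that smult_minus_one[of x] by auto
  qed
  then show ?thesis
    using assms unfolding submodule_def submodule_axioms_def
    by (auto intro!: subgroup.intro simp: a_inv_def)
qed

lemma module_hom_regular_zero:
  assumes "f \<in> module_hom R M (regular_module R)"
  shows "f \<zero>\<^bsub>M\<^esub> = \<zero>"
  using module_hom_smult[OF assms R.zero_closed M.zero_closed] module_hom_closed[OF assms M.zero_closed]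
  by (simp add: smult_l_null)

text \<open>For the idempotent e = f(x), the map from m to f(m) e x is an idempotent endomorphism of
  M with image \<open>A\<close> and kernel \<open>B\<close>, so M is their direct sum. As f(e x) = e
  is nonzero, so is \<open>A\<close>; thus \<open>B\<close> vanishes and the map is the
  identity.\<close>

lemma indecomposable_idempotent_value:
  assumes indec: "indecomposable_module R M" and f: "f \<in> module_hom R M (regular_module R)"
    and x: "x \<in> carrier M" and idem: "f x \<otimes> f x = f x" and nz: "f x \<noteq> \<zero>"
    and m: "m \<in> carrier M"
  shows "m = (f m \<otimes> f x) \<odot>\<^bsub>M\<^esub> x"
proof -
  define e where "e = f x"
  have fc: "f y \<in> carrier R" if "y \<in> carrier M" for y
    using module_hom_closed[OF f that] by simp
  have fadd: "f (y \<oplus>\<^bsub>M\<^esub> z) = f y \<oplus> f z" if "y \<in> carrier M" "z \<in> carrier M" for y z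
    using module_hom_add[OF f that] by simp
  have fsm: "f (a \<odot>\<^bsub>M\<^esub> y) = a \<otimes> f y" if "a \<in> carrier R" "y \<in> carrier M" for a y
    using module_hom_smult[OF f that] by simp
  have e: "e \<in> carrier R" "e \<otimes> e = e" "e \<noteq> \<zero>"
    using fc[OF x] idem nz by (auto simp: e_def)
  define A where "A = {(a \<otimes> e) \<odot>\<^bsub>M\<^esub> x |a. a \<in> carrier R}"
  \<comment> \<open>This is the kernel of the projection: applying f to f(y) e x returns f(y) e, so
    one vanishes exactly if the other does.\<close>
  define B where "B = {y \<in> carrier M. f y \<otimes> e = \<zero>}"
  have A: "submodule A R M"
  proof (rule submoduleI)
    show "A \<subseteq> carrier M"
      using e x by (auto simp: A_def)
    show "\<zero>\<^bsub>M\<^esub> \<in> A"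
      using e x unfolding A_def by (intro CollectI exI[of _ \<zero>]) (auto simp: smult_l_null)
    fix y assume "y \<in> A"
    then obtain a where a: "a \<in> carrier R" "y = (a \<otimes> e) \<odot>\<^bsub>M\<^esub> x"
      by (auto simp: A_def)
    show "y \<oplus>\<^bsub>M\<^esub> z \<in> A" if z: "z \<in> A" for z
    proof -
      obtain b where b: "b \<in> carrier R" "z = (b \<otimes> e) \<odot>\<^bsub>M\<^esub> x"
        using z by (auto simp: A_def)
      then have "y \<oplus>\<^bsub>M\<^esub> z = ((a \<oplus> b) \<otimes> e) \<odot>\<^bsub>M\<^esub> x"
        using a e x by (simp add: R.l_distr smult_l_distr)
      then show ?thesis
        using a b unfolding A_def by blast
    qed
    show "b \<odot>\<^bsub>M\<^esub> y \<in> A" if "b \<in> carrier R" for b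
    proof -
      have "b \<odot>\<^bsub>M\<^esub> y = (b \<otimes> a \<otimes> e) \<odot>\<^bsub>M\<^esub> x"
        using a e x that by (simp add: smult_assoc1[symmetric] R.m_assoc)
      then show ?thesis
        using a that unfolding A_def by blast
    qed
  qed
  have B: "submodule B R M"
  proof (rule submoduleI)
    show "\<zero>\<^bsub>M\<^esub> \<in> B"
      using e by (simp add: B_def module_hom_regular_zero[OF f])
  qed (use e in \<open>auto simp: B_def fadd fsm fc R.l_distr R.m_assoc\<close>)
  have proj: "\<exists>b \<in> B. y = (f y \<otimes> e) \<odot>\<^bsub>M\<^esub> x \<oplus>\<^bsub>M\<^esub> b" if y: "y \<in> carrier M" for y
  proof -
    define u where "u = (f y \<otimes> e) \<odot>\<^bsub>M\<^esub> x"
    have u: "u \<in> carrier M"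
      using e x y fc by (simp add: u_def)
    have "f u = f y \<otimes> e"
      using e x y by (simp add: u_def fsm fc e_def[symmetric] R.m_assoc)
    have "\<ominus>\<^bsub>M\<^esub> u = (\<ominus> \<one>) \<odot>\<^bsub>M\<^esub> u"
      using u by (simp add: smult_minus_one)
    then have "f (\<ominus>\<^bsub>M\<^esub> u) = \<ominus> (f y \<otimes> e)"
      using u e y fc \<open>f u = f y \<otimes> e\<close> by (simp add: fsm R.l_minus)
    \<comment> \<open>Since f(u) = f(y) e and e is idempotent, (f(y) - f(y) e) e = 0, which puts the
      remainder y - u into \<open>B\<close>.\<close>
    then have "f (y \<ominus>\<^bsub>M\<^esub> u) \<otimes> e = \<zero>"
      using u e y fc
      by (simp add: M.minus_eq fadd R.l_distr R.l_minus R.m_assoc R.r_neg)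
    moreover have "y = u \<oplus>\<^bsub>M\<^esub> (y \<ominus>\<^bsub>M\<^esub> u)"
      using u y by (metis M.a_lcomm M.a_inv_closed M.minus_eq M.r_neg M.r_zero)
    ultimately show ?thesis
      using u y unfolding B_def u_def by blast
  qed
  have "A <+>\<^bsub>M\<^esub> B = carrier M"
  proof
    show "A <+>\<^bsub>M\<^esub> B \<subseteq> carrier M"
      using e x by (auto simp: set_add_def set_mult_def A_def B_def)
    show "carrier M \<subseteq> A <+>\<^bsub>M\<^esub> B"
    proof
      fix y assume y: "y \<in> carrier M"
      obtain b where "b \<in> B" "y = (f y \<otimes> e) \<odot>\<^bsub>M\<^esub> x \<oplus>\<^bsub>M\<^esub> b"
        using proj[OF y] by blast
      moreover have "(f y \<otimes> e) \<odot>\<^bsub>M\<^esub> x \<in> A"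
        using fc[OF y] by (auto simp: A_def)
      ultimately show "y \<in> A <+>\<^bsub>M\<^esub> B"
        by (auto simp: set_add_def set_mult_def)
    qed
  qed
  moreover have "A \<inter> B = {\<zero>\<^bsub>M\<^esub>}"
  proof -
    have "y = \<zero>\<^bsub>M\<^esub>" if y: "y \<in> A" "y \<in> B" for y
    proof -
      obtain a where a: "a \<in> carrier R" "y = (a \<otimes> e) \<odot>\<^bsub>M\<^esub> x"
        using y by (auto simp: A_def)
      then have "f y \<otimes> e = a \<otimes> e"
        using e x by (simp add: fsm e_def[symmetric] R.m_assoc)
      then show ?thesis
        using y a x by (simp add: B_def smult_l_null)
    qed
    moreover have "\<zero>\<^bsub>M\<^esub> \<in> A" "\<zero>\<^bsub>M\<^esub> \<in> B"
      using A B unfolding submodule_def by (auto dest: subgroup.one_closed)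
    ultimately show ?thesis
      by blast
  qed
  ultimately have "A = {\<zero>\<^bsub>M\<^esub>} \<or> B = {\<zero>\<^bsub>M\<^esub>}"
    using indec A B unfolding indecomposable_module_def by blast
  moreover have "A \<noteq> {\<zero>\<^bsub>M\<^esub>}"
  proof
    assume "A = {\<zero>\<^bsub>M\<^esub>}"
    moreover have "(\<one> \<otimes> e) \<odot>\<^bsub>M\<^esub> x \<in> A"
      unfolding A_def by blast
    ultimately have "e \<odot>\<^bsub>M\<^esub> x = \<zero>\<^bsub>M\<^esub>"
      using e by simp
    then have "f (e \<odot>\<^bsub>M\<^esub> x) = \<zero>"
      by (simp add: module_hom_regular_zero[OF f])
    then show False
      using e x by (simp add: fsm e_def[symmetric])
  qed
  ultimately have "B = {\<zero>\<^bsub>M\<^esub>}"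
    by blast
  then show ?thesis
    using proj[OF m] m e x fc by (simp add: e_def)
qed

text \<open>The hypothesis \<open>basis\<close> is a dual basis with a single pair: the functional
  sending m to f(m) e, and the element x. For any preimage n of h(x), sending m to f(m) e n is a
  homomorphism that lifts h.\<close>

lemma projective_of_dual_basis:
  assumes f: "f \<in> module_hom R M (regular_module R)" and e: "e \<in> carrier R" and x: "x \<in> carrier M"
    and basis: "\<And>m. m \<in> carrier M \<Longrightarrow> m = (f m \<otimes> e) \<odot>\<^bsub>M\<^esub> x"
  shows "projective_module TYPE('n) TYPE('p) R M"
  unfolding projective_module_def
proof (intro allI impI, elim conjE)
  fix N :: "('a, 'n) module" and P :: "('a, 'p) module" and p h
  assume N: "left_module R N" and P: "left_module R P" and p: "p \<in> module_hom R N P"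
    and surj: "p ` carrier N = carrier P" and h: "h \<in> module_hom R M P"
  interpret N: left_module R N by (rule N)
  have fc: "f y \<in> carrier R" if "y \<in> carrier M" for y
    using module_hom_closed[OF f that] by simp
  obtain n where n: "n \<in> carrier N" "p n = h x"
    using surj module_hom_closed[OF h x] by (metis imageE)
  define g where "g m = (f m \<otimes> e) \<odot>\<^bsub>N\<^esub> n" for m
  have "g \<in> module_hom R M N"
    using n e module_hom_add[OF f] module_hom_smult[OF f]
    by (auto simp: module_hom_def g_def fc R.l_distr N.smult_l_distr R.m_assoc N.smult_assoc1)
  moreover have "p (g m) = h m" if m: "m \<in> carrier M" for m
  proof -
    have "p (g m) = (f m \<otimes> e) \<odot>\<^bsub>P\<^esub> h x"
      using n e m module_hom_smult[OF p] by (simp add: g_def fc)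
    also have "\<dots> = h ((f m \<otimes> e) \<odot>\<^bsub>M\<^esub> x)"
      using e m x module_hom_smult[OF h] by (simp add: fc)
    also have "\<dots> = h m"
      using basis[OF m] by simp
    finally show ?thesis .
  qed
  ultimately show "\<exists>g \<in> module_hom R M N. \<forall>m \<in> carrier M. p (g m) = h m"
    by blast
qed

text \<open>If every functional vanishes at x, then x and zero have the same evaluation, and
  evaluation is injective.\<close>

lemma dual_separates_points:
  assumes tl: "torsionless_module R M" and x: "x \<in> carrier M"
    and zero: "\<And>f. f \<in> carrier (dual_module R M) \<Longrightarrow> f x = \<zero>"
  shows "x = \<zero>\<^bsub>M\<^esub>"
proof -
  have "f \<zero>\<^bsub>M\<^esub> = \<zero>" if "f \<in> carrier (dual_module R M)" for f
    using that by (intro module_hom_regular_zero) (simp add: dual_module_def)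
  then have "evaluation R M x = evaluation R M \<zero>\<^bsub>M\<^esub>"
    unfolding evaluation_def by (intro restrict_ext) (simp add: zero)
  then show ?thesis
    using tl x by (auto simp: torsionless_module_iff inj_on_def)
qed

end

section \<open>Faithfulness against nilpotence of all values of the dual\<close>

lemma faithful_torsionless_nonnilpotent_value:
  assumes "artin_algebra R" and "left_module R M" and faithful: "faithful_module R M"
    and nz: "carrier M \<noteq> {\<zero>\<^bsub>M\<^esub>}" and tl: "torsionless_module R M"
  obtains f x where "f \<in> carrier (dual_module R M)" "x \<in> carrier M"
    "\<And>n::nat. f x [^]\<^bsub>R\<^esub> n \<noteq> \<zero>\<^bsub>R\<^esub>"
proof (rule ccontr)
  note witness = that
  assume "\<not> thesis"
  then have nil: "\<exists>n::nat. f x [^]\<^bsub>R\<^esub> n = \<zero>\<^bsub>R\<^esub>"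
    if "f \<in> carrier (dual_module R M)" "x \<in> carrier M" for f x
    using witness that \<open>\<not> thesis\<close> by blast
  interpret R: artin_algebra R by fact
  interpret M: left_module R M by fact
  interpret D: left_module "opposite_ring R" "dual_module R M"
    by (rule M.left_module_dual)
  have one: "\<one>\<^bsub>R\<^esub> \<noteq> \<zero>\<^bsub>R\<^esub>"
  proof
    assume "\<one>\<^bsub>R\<^esub> = \<zero>\<^bsub>R\<^esub>"
    then have "x = \<zero>\<^bsub>M\<^esub>" if "x \<in> carrier M" for x
      using M.smult_one[OF that] M.smult_l_null[OF that] by simp
    then show False
      using nz by blast
  qed
  \<comment> \<open>This element is fixed before f and x are, so that one nonzero s kills every
    value from the left and therefore all of M.\<close>
  obtain s where s: "s \<in> carrier R" "s \<noteq> \<zero>\<^bsub>R\<^esub>"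
    and min: "\<And>r. \<lbrakk>r \<in> carrier R; s \<otimes>\<^bsub>R\<^esub> r \<noteq> \<zero>\<^bsub>R\<^esub>\<rbrakk> \<Longrightarrow>
      \<exists>t \<in> carrier R. s = s \<otimes>\<^bsub>R\<^esub> r \<otimes>\<^bsub>R\<^esub> t"
    using R.minimal_right_ideal[OF one] by blast
  have kill: "s \<otimes>\<^bsub>R\<^esub> f x = \<zero>\<^bsub>R\<^esub>"
    if f: "f \<in> carrier (dual_module R M)" and x: "x \<in> carrier M" for f x
  proof (rule ccontr)
    assume ne: "s \<otimes>\<^bsub>R\<^esub> f x \<noteq> \<zero>\<^bsub>R\<^esub>"
    have fx: "f x \<in> carrier R"
      using f x by (auto simp: dual_module_def module_hom_def)
    obtain t where t: "t \<in> carrier R" "s = s \<otimes>\<^bsub>R\<^esub> f x \<otimes>\<^bsub>R\<^esub> t"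
      using min[OF fx ne] by blast
    \<comment> \<open>The dual is closed under right multiplication by t, so u is the value at x of
      another functional and is nilpotent as well.\<close>
    define u where "u = f x \<otimes>\<^bsub>R\<^esub> t"
    have u: "u \<in> carrier R" "s \<otimes>\<^bsub>R\<^esub> u = s"
      using t s fx by (auto simp: u_def R.m_assoc)
    have "t \<odot>\<^bsub>dual_module R M\<^esub> f \<in> carrier (dual_module R M)"
      using t f D.smult_closed by simp
    moreover have "(t \<odot>\<^bsub>dual_module R M\<^esub> f) x = u"
      using x by (simp add: dual_module_def u_def)
    ultimately obtain n :: nat where n: "u [^]\<^bsub>R\<^esub> n = \<zero>\<^bsub>R\<^esub>"
      using nil x by metis
    \<comment> \<open>From s = s u one gets s = s u^k for all k; a vanishing power of u then
      contradicts that s is nonzero.\<close>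
    have "s \<otimes>\<^bsub>R\<^esub> u [^]\<^bsub>R\<^esub> k = s" for k :: nat
    proof (induction k)
      case (Suc k)
      have "s \<otimes>\<^bsub>R\<^esub> u [^]\<^bsub>R\<^esub> Suc k = s \<otimes>\<^bsub>R\<^esub> u [^]\<^bsub>R\<^esub> k \<otimes>\<^bsub>R\<^esub> u"
        using s u by (simp add: R.m_assoc)
      then show ?case
        using Suc u by simp
    qed (use s in simp)
    from this[of n] show False
      using n s by simp
  qed
  have "s \<odot>\<^bsub>M\<^esub> x = \<zero>\<^bsub>M\<^esub>" if x: "x \<in> carrier M" for x
  proof (rule M.dual_separates_points[OF tl])
    show "s \<odot>\<^bsub>M\<^esub> x \<in> carrier M"
      using s x by simp
    fix f assume f: "f \<in> carrier (dual_module R M)"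
    then have "f (s \<odot>\<^bsub>M\<^esub> x) = s \<otimes>\<^bsub>R\<^esub> f x"
      using module_hom_smult[of f R M "regular_module R" s x] s x by (simp add: dual_module_def)
    then show "f (s \<odot>\<^bsub>M\<^esub> x) = \<zero>\<^bsub>R\<^esub>"
      using kill[OF f x] by simp
  qed
  then have "s \<in> annihilator R M"
    using s by (simp add: annihilator_def)
  then show False
    using s faithful by (simp add: faithful_module_def)
qed

theorem proposition3p5:
  fixes \<Lambda> :: "('a, 'r) ring_scheme"
    and M :: "('a, 'm, 's) module_scheme"
  assumes "artin_algebra \<Lambda>"
    and "left_module \<Lambda> M"
    and "finitely_generated_module \<Lambda> M"
    and "faithful_module \<Lambda> M"
    and "indecomposable_module \<Lambda> M"
    and "torsionless_module \<Lambda> M"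
  shows "projective_module TYPE('n) TYPE('p) \<Lambda> M"
proof -
  interpret artin_algebra \<Lambda> by fact
  interpret M: left_module \<Lambda> M by fact
  have "carrier M \<noteq> {\<zero>\<^bsub>M\<^esub>}"
    using assms(5) by (simp add: indecomposable_module_def)
  then obtain f x where f: "f \<in> carrier (dual_module \<Lambda> M)" and x: "x \<in> carrier M"
    and nonnil: "\<And>n::nat. f x [^]\<^bsub>\<Lambda>\<^esub> n \<noteq> \<zero>\<^bsub>\<Lambda>\<^esub>"
    using faithful_torsionless_nonnilpotent_value[OF assms(1,2,4) _ assms(6)] by blast
  have f: "f \<in> module_hom \<Lambda> M (regular_module \<Lambda>)"
    using f by (simp add: dual_module_def)
  have "f x \<in> carrier \<Lambda>"
    using module_hom_closed[OF f x] by simp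
  then obtain c where c: "c \<in> carrier \<Lambda>" "c \<otimes>\<^bsub>\<Lambda>\<^esub> f x \<noteq> \<zero>\<^bsub>\<Lambda>\<^esub>"
      "(c \<otimes>\<^bsub>\<Lambda>\<^esub> f x) \<otimes>\<^bsub>\<Lambda>\<^esub> (c \<otimes>\<^bsub>\<Lambda>\<^esub> f x) = c \<otimes>\<^bsub>\<Lambda>\<^esub> f x"
    using idempotent_multiple_of_nonnilpotent nonnil by blast
  \<comment> \<open>Left multiples of values of f are values of f: the idempotent c f(x) is attained
    at c x.\<close>
  define y where "y = c \<odot>\<^bsub>M\<^esub> x"
  have y: "y \<in> carrier M"
    using c x by (simp add: y_def)
  have fy: "f y = c \<otimes>\<^bsub>\<Lambda>\<^esub> f x"
    using module_hom_smult[OF f c(1) x] by (simp add: y_def)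
  have "f y \<in> carrier \<Lambda>"
    using module_hom_closed[OF f y] by simp
  moreover have "m = (f m \<otimes>\<^bsub>\<Lambda>\<^esub> f y) \<odot>\<^bsub>M\<^esub> y" if "m \<in> carrier M" for m
    using c fy that by (intro M.indecomposable_idempotent_value[OF assms(5) f y]) simp_all
  ultimately show ?thesis
    by (rule M.projective_of_dual_basis[OF f _ y])
qed

end
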